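(* Let $R$ be a Lie conformal superalgebra. Then $$\mathrm{GDer}(R)=\mathrm{QDer}(R)+\mathrm{QC}(R).$$
   Context: Everything is over $\mathbb{C}$. Degrees $|a|$ lie in $\mathbb{Z}_2$; whenever $|a|$ occurs, $a$ is homogeneous, and formulas are extended linearly. All $\mathbb{Z}_2$-graded $\mathbb{C}[\partial]$-modules are finitely generated. A Lie conformal superalgebra is a $\mathbb{Z}_2$-graded $\mathbb{C}[\partial]$-module $R=R_{\bar0}\oplus R_{\bar1}$ with a $\mathbb{C}$-bilinear map $R\times R\to R[\lambda]$, $(a,b)\mapsto[a_\lambda b]$, compatible with the grading, such that (C1) $[(\partial a)_\lambda b]=-\lambda[a_\lambda b]$; (C2) $[a_\lambda b]=-(-1)^{|a||b|}[b_{-\partial-\lambda}a]$ (on the right, $\nu=-\partial-\lambda$ is substituted into $[b_\nu a]=\sum_n\nu^nc_n$ with $\partial$ acting on the $c_n$); (C3) $[a_\lambda[b_\mu c]]=[[a_\lambda b]_{\lambda+\mu}c]+(-1)^{|a||b|}[b_\mu[a_\lambda c]]$. Brackets and maps are extended linearly over polynomials in the formal variables. $\mathrm{Cend}(R)_\theta$ is the space of conformal linear maps $R\to R$ of degree $\theta$: $\mathbb{C}$-linear $f_\lambda:R\to R[\lambda]$ with $f_\lambda\partial=(\partial+\lambda)f_\lambda$ and $f_\lambda(R_\mu)\subseteq R_{\mu+\theta}[\lambda]$; $\mathrm{Cend}(R)=\mathrm{Cend}(R)_{\bar0}\oplus\mathrm{Cend}(R)_{\bar1}$. For $f\in\mathrm{Cend}(R)_\theta$: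 - $f\in\mathrm{GDer}(R)_\theta$ (generalized derivation) if there are $f',f''\in\mathrm{Cend}(R)_\theta$ with $[(f_\lambda(a))_{\lambda+\mu}b]+(-1)^{\theta|a|}[a_\mu(f'_\lambda(b))]=f''_\lambda([a_\mu b])$ for all $a,b\in R$; - $f\in\mathrm{QDer}(R)_\theta$ (quasiderivation) if there is $f'\in\mathrm{Cend}(R)_\theta$ with $[(f_\lambda(a))_{\lambda+\mu}b]+(-1)^{\theta|a|}[a_\mu(f_\lambda(b))]=f'_\lambda([a_\mu b])$ for all $a,b\in R$; - $f\in\mathrm{QC}(R)_\theta$ (quasicentroid) if $[(f_\lambda(a))_{\lambda+\mu}b]=(-1)^{\theta|a|}[a_\mu(f_\lambda(b))]$ for all $a,b\in R$. $\mathrm{GDer}(R)$, $\mathrm{QDer}(R)$, $\mathrm{QC}(R)$ denote the sums of their degree $\bar0$ and degree $\bar1$ parts. *)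

theory Defs
  imports
    Complex_Main
    "HOL-Computational_Algebra.Polynomial"
    "HOL-Library.Z2"
    "HOL-Library.Set_Algebras"
    "HOL-Library.Function_Algebras"
begin

section \<open>Polynomials with coefficients in an abelian group\<close>

text \<open>
  For an abelian group \<open>R\<close>, given as a type \<open>'a\<close>, elements of \<open>R[\<lambda>]\<close> are terms of type
  \<open>'a poly\<close>. Elements of \<open>R[\<lambda>,\<mu>] = R[\<lambda>][\<mu>]\<close> are terms of type \<open>'a poly poly\<close>, where the
  \<^emph>\<open>inner\<close> variable is \<open>\<lambda>\<close> and the \<^emph>\<open>outer\<close> variable is \<open>\<mu>\<close>. As \<open>R\<close> is not a ring,
  multiplication by a formal variable is expressed by operators.
\<close>

definition const2 :: "'a::zero \<Rightarrow> 'a poly poly"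
  where "const2 c = [:[:c:]:]"

definition lam2 :: "'a::zero poly poly \<Rightarrow> 'a poly poly"
  where "lam2 = map_poly (pCons 0)"

definition mu2 :: "'a::zero poly poly \<Rightarrow> 'a poly poly"
  where "mu2 = pCons 0"

definition lammu2 :: "'a::ab_group_add poly poly \<Rightarrow> 'a poly poly"
  where "lammu2 q = lam2 q + mu2 q"

text \<open>
  For \<open>p = (\<Sum>n. \<nu>\<^sup>n c\<^sub>n)\<close>, \<open>psubst T h p\<close> is \<open>\<Sum>n. T\<^sup>n (h c\<^sub>n)\<close>: the variable \<open>\<nu>\<close> is replaced
  by the operator \<open>T\<close> on the target, after applying \<open>h\<close> to each coefficient.
\<close>

definition psubst :: "('b \<Rightarrow> 'b) \<Rightarrow> ('a \<Rightarrow> 'b) \<Rightarrow> 'a::zero poly \<Rightarrow> 'b::comm_monoid_add"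
  where "psubst T h p = (\<Sum>n\<le>degree p. (T ^^ n) (h (coeff p n)))"

text \<open>
  \<open>apply_ext S T f p\<close> is \<open>f\<^sub>t(p(s)) = (\<Sum>n. s\<^sup>n f\<^sub>t(c\<^sub>n))\<close> for \<open>p(s) = (\<Sum>n. s\<^sup>n c\<^sub>n)\<close>, i.e. the
  linear extension of \<open>f\<close> over polynomials in \<open>s\<close>; here \<open>S\<close> and \<open>T\<close> are multiplication by
  \<open>s\<close> and by \<open>t\<close> on \<open>R[\<lambda>,\<mu>]\<close>.
\<close>

definition apply_ext ::
  "('a poly poly \<Rightarrow> 'a poly poly) \<Rightarrow> ('a poly poly \<Rightarrow> 'a poly poly) \<Rightarrow>
    ('a::ab_group_add \<Rightarrow> 'a poly) \<Rightarrow> 'a poly \<Rightarrow> 'a poly poly"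
  where "apply_ext S T f p = psubst S (\<lambda>c. psubst T const2 (f c)) p"

definition polys_over :: "'a::zero set \<Rightarrow> 'a poly set"
  where "polys_over V = {p. \<forall>n. coeff p n \<in> V}"

text \<open>\<open>koszul d x\<close> is \<open>(-1)\<^sup>d x\<close>.\<close>

definition koszul :: "bit \<Rightarrow> 'b::ab_group_add \<Rightarrow> 'b"
  where "koszul d x = (if d = 1 then - x else x)"


section \<open>Lie conformal superalgebras\<close>

text \<open>
  A \<open>\<complex>[\<partial>]\<close>-module is a module over the ring \<^typ>\<open>complex poly\<close>; the operator \<open>\<partial>\<close> is the
  action of the polynomial \<open>[:0, 1:]\<close>, and \<open>\<complex>\<close> acts through the constant polynomials.
\<close>

abbreviation del :: "(complex poly \<Rightarrow> 'a \<Rightarrow> 'a) \<Rightarrow> 'a \<Rightarrow> 'a"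
  where "del act \<equiv> act [:0, 1:]"

definition clinear_to_poly ::
  "(complex poly \<Rightarrow> 'a \<Rightarrow> 'a) \<Rightarrow> ('a::ab_group_add \<Rightarrow> 'a poly) \<Rightarrow> bool"
  where "clinear_to_poly act f \<longleftrightarrow>
    Vector_Spaces.linear (\<lambda>c. act [:c:]) (\<lambda>c. map_poly (act [:c:])) f"

text \<open>\<open>R d\<close> is the homogeneous component of degree \<open>d\<close>; the whole module is the type \<open>'a\<close>.\<close>

locale fg_graded_module = module act
  for act :: "complex poly \<Rightarrow> 'a::ab_group_add \<Rightarrow> 'a" +
  fixes R :: "bit \<Rightarrow> 'a set"
  assumes finitely_generated: "\<exists>S. finite S \<and> span S = UNIV"
    and component_submodule: "subspace (R d)"
    and components_sum: "\<exists>x0\<in>R 0. \<exists>x1\<in>R 1. x = x0 + x1"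
    and components_disjoint: "R 0 \<inter> R 1 = {0}"

locale lie_conformal_superalgebra = fg_graded_module act R
  for act :: "complex poly \<Rightarrow> 'a::ab_group_add \<Rightarrow> 'a" and R :: "bit \<Rightarrow> 'a set" +
  fixes br :: "'a \<Rightarrow> 'a \<Rightarrow> 'a poly"
  assumes linear_left: "clinear_to_poly act (\<lambda>a. br a b)"
    and linear_right: "clinear_to_poly act (\<lambda>b. br a b)"
    and graded: "a \<in> R d \<Longrightarrow> b \<in> R e \<Longrightarrow> br a b \<in> polys_over (R (d + e))"
    and sesquilinear: "br (del act a) b = - pCons 0 (br a b)"
    and skew_symmetry: "a \<in> R d \<Longrightarrow> b \<in> R e \<Longrightarrow>
      br a b = - koszul (d * e)
        (psubst (\<lambda>q. - map_poly (del act) q - pCons 0 q) (\<lambda>c. [:c:]) (br b a))"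
    and jacobi: "a \<in> R d \<Longrightarrow> b \<in> R e \<Longrightarrow>
      apply_ext mu2 lam2 (br a) (br b c) =
        apply_ext lam2 lammu2 (\<lambda>x. br x c) (br a b)
        + koszul (d * e) (apply_ext lam2 mu2 (br b) (br a c))"


section \<open>Conformal linear maps and generalized derivations\<close>

definition Cend_deg ::
  "(complex poly \<Rightarrow> 'a::ab_group_add \<Rightarrow> 'a) \<Rightarrow> (bit \<Rightarrow> 'a set) \<Rightarrow> bit \<Rightarrow> ('a \<Rightarrow> 'a poly) set"
  where "Cend_deg act R \<theta> =
    {f. clinear_to_poly act f
      \<and> (\<forall>x. f (del act x) = map_poly (del act) (f x) + pCons 0 (f x))
      \<and> (\<forall>d. \<forall>x\<in>R d. f x \<in> polys_over (R (d + \<theta>)))}"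

text \<open>
  The three kinds of terms in the defining identities below: \<open>[(f\<^sub>\<lambda>(a))\<^bsub>\<lambda>+\<mu>\<^esub> b]\<close>,
  \<open>[a\<^sub>\<mu> (f\<^sub>\<lambda>(b))]\<close> and \<open>f\<^sub>\<lambda>([a\<^sub>\<mu> b])\<close>.
\<close>

definition br_left ::
  "('a::ab_group_add \<Rightarrow> 'a \<Rightarrow> 'a poly) \<Rightarrow> ('a \<Rightarrow> 'a poly) \<Rightarrow> 'a \<Rightarrow> 'a \<Rightarrow> 'a poly poly"
  where "br_left br f a b = apply_ext lam2 lammu2 (\<lambda>x. br x b) (f a)"

definition br_right ::
  "('a::ab_group_add \<Rightarrow> 'a \<Rightarrow> 'a poly) \<Rightarrow> ('a \<Rightarrow> 'a poly) \<Rightarrow> 'a \<Rightarrow> 'a \<Rightarrow> 'a poly poly"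
  where "br_right br f a b = apply_ext lam2 mu2 (br a) (f b)"

definition map_br ::
  "('a::ab_group_add \<Rightarrow> 'a \<Rightarrow> 'a poly) \<Rightarrow> ('a \<Rightarrow> 'a poly) \<Rightarrow> 'a \<Rightarrow> 'a \<Rightarrow> 'a poly poly"
  where "map_br br f a b = apply_ext mu2 lam2 f (br a b)"

definition GDer_deg ::
  "(complex poly \<Rightarrow> 'a::ab_group_add \<Rightarrow> 'a) \<Rightarrow> (bit \<Rightarrow> 'a set) \<Rightarrow> ('a \<Rightarrow> 'a \<Rightarrow> 'a poly) \<Rightarrow>
    bit \<Rightarrow> ('a \<Rightarrow> 'a poly) set"
  where "GDer_deg act R br \<theta> =
    {f \<in> Cend_deg act R \<theta>. \<exists>f'\<in>Cend_deg act R \<theta>. \<exists>f''\<in>Cend_deg act R \<theta>.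
      \<forall>d. \<forall>a\<in>R d. \<forall>b.
        br_left br f a b + koszul (\<theta> * d) (br_right br f' a b) = map_br br f'' a b}"

definition QDer_deg ::
  "(complex poly \<Rightarrow> 'a::ab_group_add \<Rightarrow> 'a) \<Rightarrow> (bit \<Rightarrow> 'a set) \<Rightarrow> ('a \<Rightarrow> 'a \<Rightarrow> 'a poly) \<Rightarrow>
    bit \<Rightarrow> ('a \<Rightarrow> 'a poly) set"
  where "QDer_deg act R br \<theta> =
    {f \<in> Cend_deg act R \<theta>. \<exists>f'\<in>Cend_deg act R \<theta>.
      \<forall>d. \<forall>a\<in>R d. \<forall>b.
        br_left br f a b + koszul (\<theta> * d) (br_right br f a b) = map_br br f' a b}"

definition QC_deg ::
  "(complex poly \<Rightarrow> 'a::ab_group_add \<Rightarrow> 'a) \<Rightarrow> (bit \<Rightarrow> 'a set) \<Rightarrow> ('a \<Rightarrow> 'a \<Rightarrow> 'a poly) \<Rightarrow>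
    bit \<Rightarrow> ('a \<Rightarrow> 'a poly) set"
  where "QC_deg act R br \<theta> =
    {f \<in> Cend_deg act R \<theta>.
      \<forall>d. \<forall>a\<in>R d. \<forall>b. br_left br f a b = koszul (\<theta> * d) (br_right br f a b)}"

text \<open>Sums of sets of maps are elementwise, and sums of maps are pointwise.\<close>

definition GDer ::
  "(complex poly \<Rightarrow> 'a::ab_group_add \<Rightarrow> 'a) \<Rightarrow> (bit \<Rightarrow> 'a set) \<Rightarrow> ('a \<Rightarrow> 'a \<Rightarrow> 'a poly) \<Rightarrow>
    ('a \<Rightarrow> 'a poly) set"
  where "GDer act R br = GDer_deg act R br 0 + GDer_deg act R br 1"

definition QDer ::
  "(complex poly \<Rightarrow> 'a::ab_group_add \<Rightarrow> 'a) \<Rightarrow> (bit \<Rightarrow> 'a set) \<Rightarrow> ('a \<Rightarrow> 'a \<Rightarrow> 'a poly) \<Rightarrow>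
    ('a \<Rightarrow> 'a poly) set"
  where "QDer act R br = QDer_deg act R br 0 + QDer_deg act R br 1"

definition QC ::
  "(complex poly \<Rightarrow> 'a::ab_group_add \<Rightarrow> 'a) \<Rightarrow> (bit \<Rightarrow> 'a set) \<Rightarrow> ('a \<Rightarrow> 'a \<Rightarrow> 'a poly) \<Rightarrow>
    ('a \<Rightarrow> 'a poly) set"
  where "QC act R br = QC_deg act R br 0 + QC_deg act R br 1"

end

theory Submission
  imports Defs
begin

text \<open>
  Let \<open>f\<close> be a generalized derivation of degree \<open>\<theta>\<close> with companions \<open>f'\<close>, \<open>f''\<close>. Writing the
  defining identity for \<open>(b, a)\<close>, substituting \<open>- \<partial> - \<lambda> - \<mu>\<close> for \<open>\<mu>\<close> and using skew symmetry
  yields the defining identity for \<open>(a, b)\<close> with \<open>f\<close> and \<open>f'\<close> interchanged. Adding and subtracting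
  the two identities shows that \<open>(f + f') / 2\<close> is a quasiderivation (with companion \<open>f''\<close>) and that
  \<open>(f - f') / 2\<close> lies in the quasicentroid.
\<close>

section \<open>Substitution into polynomials\<close>

lemma bit_cases [case_names zero one]:
  fixes d :: bit
  obtains "d = 0" | "d = 1"
  by (cases d) auto

section \<open>Additivity of the operators on polynomials\<close>

lemma additive_map_poly:
  fixes A :: "'a::ab_group_add \<Rightarrow> 'b::ab_group_add"
  assumes "additive A"
  shows "additive (map_poly A)"
proof -
  interpret additive A by fact
  show ?thesis
    by standard (simp add: poly_eq_iff coeff_map_poly add zero)
qed

lemma additive_pCons_0: "additive (pCons (0::'a::ab_group_add))"
  by standard simp

lemma additive_lam2: "additive (lam2 :: 'a::ab_group_add poly poly \<Rightarrow> _)"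
  unfolding lam2_def by (intro additive_map_poly additive_pCons_0)

lemma additive_mu2: "additive (mu2 :: 'a::ab_group_add poly poly \<Rightarrow> _)"
  unfolding mu2_def by (rule additive_pCons_0)

lemma additive_lammu2: "additive (lammu2 :: 'a::ab_group_add poly poly \<Rightarrow> _)"
  by standard (simp add: lammu2_def additive.add[OF additive_lam2] additive.add[OF additive_mu2])

lemma additive_const2: "additive (const2 :: 'a::ab_group_add \<Rightarrow> _)"
  by standard (simp add: const2_def)

lemma lam2_mu2: "lam2 (mu2 q) = mu2 (lam2 q)" for q :: "'a::ab_group_add poly poly"
  by (simp add: lam2_def mu2_def map_poly_pCons)

text \<open>Terms beyond the degree vanish because \<open>h 0 = 0\<close> and \<open>T\<close> is
  additive. A freely chosen bound gives several polynomials a common summation range.\<close>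

lemma psubst_eq_sum:
  fixes T :: "'b \<Rightarrow> 'b::ab_group_add"
  assumes T: "additive T" and "h 0 = 0" and "degree p \<le> N"
  shows "psubst T h p = (\<Sum>n\<le>N. (T ^^ n) (h (coeff p n)))"
proof -
  have "(T ^^ n) 0 = 0" for n
    by (induction n) (simp_all add: additive.zero[OF T])
  then show ?thesis
    unfolding psubst_def using assms(2,3)
    by (intro sum.mono_neutral_left) (auto simp: coeff_eq_0)
qed

text \<open>This is the Horner recursion. With \<open>psubst_0\<close> it reduces later facts about
  \<open>psubst\<close> to inductions on the polynomial, without sums over coefficients.\<close>

lemma psubst_pCons:
  fixes T :: "'b \<Rightarrow> 'b::ab_group_add"
  assumes T: "additive T" and "h 0 = 0"
  shows "psubst T h (pCons c p) = h c + T (psubst T h p)"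
proof -
  have "psubst T h (pCons c p) = (\<Sum>n\<le>Suc (degree p). (T ^^ n) (h (coeff (pCons c p) n)))"
    by (rule psubst_eq_sum[OF T]) (use assms in \<open>simp_all add: degree_pCons_le\<close>)
  also have "\<dots> = h c + (\<Sum>n\<le>degree p. T ((T ^^ n) (h (coeff p n))))"
    by (simp add: sum.atMost_Suc_shift del: sum.atMost_Suc)
  also have "\<dots> = h c + T (psubst T h p)"
    by (simp add: psubst_def additive.sum[OF T])
  finally show ?thesis .
qed

lemma psubst_0: "h 0 = 0 \<Longrightarrow> psubst T h 0 = 0"
  by (simp add: psubst_def)

lemma additive_psubst:
  fixes T :: "'b \<Rightarrow> 'b::ab_group_add" and h :: "'a::ab_group_add \<Rightarrow> 'b"
  assumes T: "additive T" and h: "additive h"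
  shows "additive (psubst T h)"
proof
  fix p q :: "'a poly"
  have h0: "h 0 = 0" by (rule additive.zero[OF h])
  have Tn: "(T ^^ n) (x + y) = (T ^^ n) x + (T ^^ n) y" for n x y
    by (induction n) (simp_all add: additive.add[OF T])
  define N where "N = max (degree p) (degree q)"
  have "psubst T h r = (\<Sum>n\<le>N. (T ^^ n) (h (coeff r n)))" if "r \<in> {p, q, p + q}" for r
    by (rule psubst_eq_sum) (use T h0 that in \<open>auto simp: N_def degree_add_le_max\<close>)
  then show "psubst T h (p + q) = psubst T h p + psubst T h q"
    by (simp add: Tn additive.add[OF h] sum.distrib)
qed

text \<open>Skew symmetry is available for homogeneous elements only, and the coefficients of
  \<open>f a\<close> are homogeneous when \<open>a\<close> is; hence agreement is demanded only at
  the coefficients.\<close>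

lemma psubst_cong:
  assumes "\<And>n. h (coeff p n) = h' (coeff p n)"
  shows "psubst T h p = psubst T h' p"
  by (simp add: psubst_def assms)

text \<open>By the Horner recursion, \<open>G\<close> moves past each occurrence of \<open>T\<close>
  and turns it into \<open>T'\<close>. In the changes of variable below, \<open>G\<close> is the
  substitution performed and \<open>T'\<close> the operator that replaces \<open>T\<close>.\<close>

lemma additive_comp_psubst:
  fixes T :: "'b \<Rightarrow> 'b::ab_group_add" and T' :: "'c \<Rightarrow> 'c::ab_group_add"
  assumes G: "additive G" and T: "additive T" and T': "additive T'"
    and h0: "h 0 = 0" and comm: "\<And>q. G (T q) = T' (G q)"
  shows "G (psubst T h p) = psubst T' (\<lambda>c. G (h c)) p"
  by (induction p)
    (simp_all add: psubst_0 psubst_pCons T T' h0 comm additive.add[OF G] additive.zero[OF G])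

lemma psubst_map_poly:
  fixes T :: "'b \<Rightarrow> 'b::ab_group_add"
  assumes "additive T" and "h 0 = 0" and "A 0 = 0"
  shows "psubst T h (map_poly A p) = psubst T (\<lambda>c. h (A c)) p"
  by (induction p) (simp_all add: psubst_0 psubst_pCons map_poly_pCons assms)

lemma psubst_add_fun:
  fixes T :: "'b \<Rightarrow> 'b::ab_group_add"
  assumes T: "additive T" and "h 0 = 0" and "k 0 = 0"
  shows "psubst T (\<lambda>c. h c + k c) p = psubst T h p + psubst T k p"
  by (induction p) (simp_all add: psubst_0 psubst_pCons assms additive.add[OF T])

section \<open>Koszul signs\<close>

lemma additive_koszul: "additive (koszul d)"
  by standard (simp add: koszul_def)

lemma koszul_commute: "additive G \<Longrightarrow> G (koszul d x) = koszul d (G x)"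
  by (simp add: koszul_def additive.minus)

lemma minus_koszul_minus_koszul: "- koszul d (- koszul d x) = x"
  by (simp add: koszul_def)

lemma koszul_psubst:
  fixes T :: "'b \<Rightarrow> 'b::ab_group_add"
  assumes "additive T" and "h 0 = 0"
  shows "psubst T (\<lambda>c. - koszul d (h c)) p = - koszul d (psubst T h p)"
proof -
  have "additive (\<lambda>x. - koszul d x :: 'b)"
    by standard (simp add: koszul_def)
  then show ?thesis
    using assms additive_comp_psubst[of "\<lambda>x. - koszul d x" T T h p]
    by (simp add: koszul_commute additive.minus[OF assms(1)])
qed

lemma additive_uminus_minus:
  assumes "additive F" and "additive G"
  shows "additive (\<lambda>q. - F q - G q)"
  by standard (simp add: additive.add[OF assms(1)] additive.add[OF assms(2)])


section \<open>Coefficientwise operators\<close>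

abbreviation map_poly2 :: "('a::zero \<Rightarrow> 'b::zero) \<Rightarrow> 'a poly poly \<Rightarrow> 'b poly poly"
  where "map_poly2 A \<equiv> map_poly (map_poly A)"

lemma map_poly2_lam2: "A 0 = 0 \<Longrightarrow> map_poly2 A (lam2 q) = lam2 (map_poly2 A q)"
  by (simp add: lam2_def poly_eq_iff coeff_map_poly map_poly_pCons)

lemma map_poly2_mu2: "A 0 = 0 \<Longrightarrow> map_poly2 A (mu2 q) = mu2 (map_poly2 A q)"
  by (simp add: mu2_def map_poly_pCons)

lemma map_poly2_lammu2:
  "additive A \<Longrightarrow> map_poly2 A (lammu2 q) = lammu2 (map_poly2 A q)"
  by (simp add: lammu2_def map_poly2_lam2 map_poly2_mu2 additive.zero
      additive.add[OF additive_map_poly[OF additive_map_poly]])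

lemma map_poly2_const2: "A 0 = 0 \<Longrightarrow> map_poly2 A (const2 c) = const2 (A c)"
  by (simp add: const2_def map_poly_pCons)

lemma map_poly2_psubst:
  fixes A :: "'a::ab_group_add \<Rightarrow> 'a"
  assumes A: "additive A" and T: "additive T"
    and comm: "\<And>q. map_poly2 A (T q) = T (map_poly2 A q)"
    and h0: "h 0 = 0" and h: "\<And>c. map_poly2 A (h c) = h (A c)"
  shows "map_poly2 A (psubst T h p) = psubst T h (map_poly A p)"
proof -
  note A0 = additive.zero[OF A]
  have "map_poly2 A (psubst T h p) = psubst T (\<lambda>c. map_poly2 A (h c)) p"
    by (rule additive_comp_psubst[OF additive_map_poly[OF additive_map_poly[OF A]] T T])
      (fact h0 comm)+
  then show ?thesis
    using h0 T A0 by (simp add: h psubst_map_poly)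
qed

text \<open>The substitution of \<open>- \<partial> - \<lambda> - \<mu>\<close> for \<open>\<mu>\<close>, the operator \<open>\<partial>\<close> being \<open>A\<close>.\<close>

definition refl_mu :: "('a \<Rightarrow> 'a) \<Rightarrow> 'a::ab_group_add poly poly \<Rightarrow> 'a poly poly"
  where "refl_mu A = psubst (\<lambda>q. - map_poly2 A q - lammu2 q) (\<lambda>q. [:q:])"

section \<open>Effect of the substitution on variables and constants\<close>

context
  fixes A :: "'a::ab_group_add \<Rightarrow> 'a"
  assumes A: "additive A"
begin

lemma additive_map_poly2: "additive (map_poly2 A)"
  by (intro additive_map_poly A)

lemma additive_refl_lammu: "additive (\<lambda>q. - map_poly2 A q - lammu2 q)"
  by (intro additive_uminus_minus additive_map_poly2 additive_lammu2)

lemma additive_refl: "additive (\<lambda>q. - map_poly2 A q - mu2 q)"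
  by (intro additive_uminus_minus additive_map_poly2 additive_mu2)

lemma additive_refl_mu: "additive (refl_mu A)"
  unfolding refl_mu_def
  by (rule additive_psubst[OF additive_refl_lammu]) (standard, simp)

lemma refl_mu_mu2: "refl_mu A (mu2 q) = - map_poly2 A (refl_mu A q) - lammu2 (refl_mu A q)"
  by (simp add: refl_mu_def mu2_def psubst_pCons[OF additive_refl_lammu])

lemma refl_mu_lam2: "refl_mu A (lam2 q) = lam2 (refl_mu A q)"
proof -
  have comm: "lam2 (- map_poly2 A p - lammu2 p) = - map_poly2 A (lam2 p) - lammu2 (lam2 p)" for p
    by (simp add: additive.diff[OF additive_lam2] additive.minus[OF additive_lam2]
        additive.add[OF additive_lam2] map_poly2_lam2 additive.zero[OF A] lammu2_def lam2_mu2)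
  have "lam2 (refl_mu A q)
      = psubst (\<lambda>q. - map_poly2 A q - lammu2 q) (\<lambda>c. lam2 [:c:]) q"
    unfolding refl_mu_def
    by (rule additive_comp_psubst[OF additive_lam2 additive_refl_lammu additive_refl_lammu])
      (simp_all add: comm)
  also have "\<dots> = refl_mu A (lam2 q)"
    unfolding refl_mu_def lam2_def
    by (simp add: psubst_map_poly[OF additive_refl_lammu] map_poly_pCons)
  finally show ?thesis by simp
qed

text \<open>The variable \<lambda> is fixed, so it cancels in \<lambda> + (-\<partial> - \<lambda> -
  \<mu>). This is why the substitution can exchange brackets at \<lambda> + \<mu> with brackets at
  \<mu>.\<close>

lemma refl_mu_lammu2: "refl_mu A (lammu2 q) = - map_poly2 A (refl_mu A q) - mu2 (refl_mu A q)"
  by (simp add: lammu2_def additive.add[OF additive_refl_mu] refl_mu_lam2 refl_mu_mu2)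

lemma refl_mu_const2: "refl_mu A (const2 c) = const2 c"
  by (simp add: refl_mu_def const2_def psubst_pCons[OF additive_refl_lammu] psubst_0
      additive.zero[OF additive_map_poly2] additive.zero[OF additive_lammu2])

lemma refl_mu_psubst:
  assumes T: "additive T" and T': "additive T'" and h0: "h 0 = 0"
    and comm: "\<And>q. refl_mu A (T q) = T' (refl_mu A q)"
  shows "refl_mu A (psubst T h p) = psubst T' (\<lambda>c. refl_mu A (h c)) p"
  by (rule additive_comp_psubst[OF additive_refl_mu T T']) (fact h0 comm)+

lemma refl_mu_psubst_lam2:
  "refl_mu A (psubst lam2 const2 p) = psubst lam2 const2 p"
  by (subst refl_mu_psubst[OF additive_lam2 additive_lam2])
    (simp_all add: refl_mu_lam2 refl_mu_const2 additive.zero[OF additive_const2])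

text \<open>With \<partial> for \<open>A\<close>, a bracket at \<mu> becomes a bracket at
  -\<partial> - (\<lambda> + \<mu>), the shape in which skew symmetry yields a bracket at \<lambda>
  + \<mu>.\<close>

lemma refl_mu_psubst_mu2:
  "refl_mu A (psubst mu2 const2 p) = psubst (\<lambda>q. - map_poly2 A q - lammu2 q) const2 p"
  by (subst refl_mu_psubst[OF additive_mu2 additive_refl_lammu])
    (simp_all add: refl_mu_mu2 refl_mu_const2 additive.zero[OF additive_const2])

lemma refl_mu_psubst_lammu2:
  "refl_mu A (psubst lammu2 const2 p) = psubst (\<lambda>q. - map_poly2 A q - mu2 q) const2 p"
  by (subst refl_mu_psubst[OF additive_lammu2 additive_refl])
    (simp_all add: refl_mu_lammu2 refl_mu_const2 additive.zero[OF additive_const2])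

end


section \<open>Conformal linear maps\<close>

context lie_conformal_superalgebra
begin

lemma additive_act: "additive (act p)"
  by standard (rule scale_right_distrib)

text \<open>The vector space axioms for both scalar actions follow from the module axioms along
  constant polynomials, so only the two conditions on \<open>f\<close> itself remain.\<close>

lemma clinear_to_poly_iff:
  "clinear_to_poly act f \<longleftrightarrow>
    additive f \<and> (\<forall>c x. f (act [:c:] x) = map_poly (act [:c:]) (f x))"
proof -
  have scalar: "vector_space (\<lambda>c. act [:c:])"
  proof
    fix a b :: complex and x y :: 'a
    show "act [:a:] (x + y) = act [:a:] x + act [:a:] y"
      by (rule scale_right_distrib)
    show "act [:a + b:] x = act [:a:] x + act [:b:] x"
      using scale_left_distrib[of "[:a:]" "[:b:]" x] by simp
    show "act [:a:] (act [:b:] x) = act [:a * b:] x"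
      by (simp add: mult.commute)
    show "act [:1:] x = x"
      using scale_one[of x] by (simp add: one_pCons)
  qed
  then interpret V: vector_space "\<lambda>c. act [:c:]" .
  have "vector_space (\<lambda>c. map_poly (act [:c:]))"
    by standard (simp_all add: poly_eq_iff coeff_map_poly V.scale_left_distrib scale_right_distrib
        flip: one_pCons)
  with scalar show ?thesis
    by (auto simp: clinear_to_poly_def Vector_Spaces.linear_iff additive_def)
qed

lemma additive_br_left: "additive (\<lambda>x. br x b)"
  using linear_left by (simp add: clinear_to_poly_iff)

lemma additive_br_right: "additive (br a)"
  using linear_right[of a] by (simp add: clinear_to_poly_iff)

lemma br_scale:
  "br (act [:c:] a) b = map_poly (act [:c:]) (br a b)"
  "br a (act [:c:] b) = map_poly (act [:c:]) (br a b)"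
  using linear_left[of b] linear_right[of a] by (simp_all add: clinear_to_poly_iff)

lemma CendD:
  assumes "f \<in> Cend_deg act R \<theta>"
  shows Cend_additive: "additive f"
    and Cend_scale: "f (act [:c:] x) = map_poly (act [:c:]) (f x)"
    and Cend_del: "f (del act x) = map_poly (del act) (f x) + pCons 0 (f x)"
    and Cend_coeff: "x \<in> R d \<Longrightarrow> coeff (f x) n \<in> R (d + \<theta>)"
  using assms by (auto simp: Cend_deg_def polys_over_def clinear_to_poly_iff)

abbreviation cscale :: "complex \<Rightarrow> ('a \<Rightarrow> 'a poly) \<Rightarrow> 'a \<Rightarrow> 'a poly"
  where "cscale c f \<equiv> (\<lambda>x. map_poly (act [:c:]) (f x))"

section \<open>Sums and scalar multiples of conformal linear maps\<close>

lemma Cend_degI: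
  assumes "additive f" and "\<And>c x. f (act [:c:] x) = map_poly (act [:c:]) (f x)"
    and "\<And>x. f (del act x) = map_poly (del act) (f x) + pCons 0 (f x)"
    and "\<And>d x n. x \<in> R d \<Longrightarrow> coeff (f x) n \<in> R (d + \<theta>)"
  shows "f \<in> Cend_deg act R \<theta>"
  using assms by (auto simp only: Cend_deg_def polys_over_def clinear_to_poly_iff)

lemma Cend_deg_add:
  assumes f: "f \<in> Cend_deg act R \<theta>" and g: "g \<in> Cend_deg act R \<theta>"
  shows "(\<lambda>x. f x + g x) \<in> Cend_deg act R \<theta>"
proof (rule Cend_degI)
  show "additive (\<lambda>x. f x + g x)"
    by standard (simp add: additive.add[OF Cend_additive[OF f]] additive.add[OF Cend_additive[OF g]])
  show "coeff (f x + g x) n \<in> R (d + \<theta>)" if "x \<in> R d" for x d n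
    using subspace_add[OF component_submodule Cend_coeff[OF f that] Cend_coeff[OF g that]]
    by (simp del: add_bit_eq_xor)
qed (simp_all add: Cend_scale[OF f] Cend_scale[OF g] Cend_del[OF f] Cend_del[OF g]
    additive.add[OF additive_map_poly[OF additive_act]])

lemma Cend_deg_cscale:
  assumes f: "f \<in> Cend_deg act R \<theta>"
  shows "cscale c f \<in> Cend_deg act R \<theta>"
proof (rule Cend_degI)
  note add = additive.add[OF additive_map_poly[OF additive_act]]
  \<comment> \<open>The ring of polynomials in \<partial> is commutative, so scalars commute with
    \<partial>.\<close>
  have comm: "map_poly (act p) (map_poly (act q) r) = map_poly (act q) (map_poly (act p) r)" for p q r
    by (simp add: poly_eq_iff coeff_map_poly mult.commute)
  show "additive (cscale c f)"
    by standard (simp add: additive.add[OF Cend_additive[OF f]] add)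
  show "cscale c f (act [:c':] x) = map_poly (act [:c':]) (cscale c f x)" for c' x
    by (simp only: Cend_scale[OF f] comm)
  show "cscale c f (del act x) = map_poly (del act) (cscale c f x) + pCons 0 (cscale c f x)" for x
    by (simp only: Cend_del[OF f] add comm[of "[:c:]"]) (simp add: map_poly_pCons)
  show "coeff (cscale c f x) n \<in> R (d + \<theta>)" if "x \<in> R d" for x d n
    using subspace_scale[OF component_submodule Cend_coeff[OF f that]]
    by (simp add: coeff_map_poly)
qed

section \<open>Linearity of the terms in the defining identities\<close>

lemma additive_psubst_br_left:
  "additive T \<Longrightarrow> additive (\<lambda>x. psubst T const2 (br x b))"
  using additive_psubst[OF _ additive_const2, of T]
  by (simp add: additive_def additive.add[OF additive_br_left])

lemma additive_psubst_br_right: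
  "additive T \<Longrightarrow> additive (\<lambda>x. psubst T const2 (br a x))"
  using additive_psubst[OF _ additive_const2, of T]
  by (simp add: additive_def additive.add[OF additive_br_right])

lemma br_left_add: "br_left br (\<lambda>x. f x + g x) a b = br_left br f a b + br_left br g a b"
  unfolding br_left_def apply_ext_def
  using additive.add[OF additive_psubst[OF additive_lam2 additive_psubst_br_left[OF additive_lammu2]]]
  by simp

lemma br_right_add: "br_right br (\<lambda>x. f x + g x) a b = br_right br f a b + br_right br g a b"
  unfolding br_right_def apply_ext_def
  using additive.add[OF additive_psubst[OF additive_lam2 additive_psubst_br_right[OF additive_mu2]]]
  by simp

lemma additive_psubst_Cend:
  fixes f :: "'a \<Rightarrow> 'a poly"
  shows "additive f \<Longrightarrow> additive (\<lambda>x. psubst lam2 const2 (f x))"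
  by (simp add: additive_def additive.add[OF additive_psubst[OF additive_lam2 additive_const2]])

lemma map_poly2_psubst_const2:
  fixes A :: "'a \<Rightarrow> 'a"
  assumes "additive A" and "T \<in> {lam2, mu2, lammu2}"
  shows "map_poly2 A (psubst T const2 p) = psubst T const2 (map_poly A p)"
  using assms
  by (intro map_poly2_psubst)
    (auto simp: additive_lam2 additive_mu2 additive_lammu2 map_poly2_lam2 map_poly2_mu2
      map_poly2_lammu2 map_poly2_const2 additive.zero additive.zero[OF additive_const2])

lemma br_left_cscale:
  "br_left br (cscale c f) a b = map_poly2 (act [:c:]) (br_left br f a b)"
  unfolding br_left_def apply_ext_def
  by (rule map_poly2_psubst[symmetric])
    (auto simp: additive_act additive_lam2 map_poly2_lam2 map_poly2_psubst_const2 br_scale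
      additive.zero[OF additive_psubst_br_left[OF additive_lammu2]])

lemma br_right_cscale:
  "br_right br (cscale c f) a b = map_poly2 (act [:c:]) (br_right br f a b)"
  unfolding br_right_def apply_ext_def
  by (rule map_poly2_psubst[symmetric])
    (auto simp: additive_act additive_lam2 map_poly2_lam2 map_poly2_psubst_const2 br_scale
      additive.zero[OF additive_psubst_br_right[OF additive_mu2]])

text \<open>The defining identities range over all \<open>b\<close>, but skew symmetry needs
  \<open>b\<close> homogeneous. Additivity in \<open>b\<close>, here and in the next two lemmas,
  bridges the gap.\<close>

lemma additive_br_left_snd: "additive (br_left br f a)"
  unfolding br_left_def apply_ext_def additive_def
  by (simp add: additive.add[OF additive_br_right] psubst_add_fun[OF additive_lam2]
      additive.add[OF additive_psubst[OF additive_lammu2 additive_const2]]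
      additive.zero[OF additive_psubst_br_left[OF additive_lammu2]])

lemma additive_br_right_snd:
  assumes "additive f"
  shows "additive (br_right br f a)"
  unfolding br_right_def apply_ext_def additive_def
  by (simp add: additive.add[OF assms]
      additive.add[OF additive_psubst[OF additive_lam2 additive_psubst_br_right[OF additive_mu2]]])

lemma additive_map_br_snd:
  assumes "additive f"
  shows "additive (map_br br f a)"
  unfolding map_br_def apply_ext_def additive_def
  by (simp add: additive.add[OF additive_br_right]
      additive.add[OF additive_psubst[OF additive_mu2 additive_psubst_Cend[OF assms]]])


section \<open>Interchanging the two arguments\<close>

text \<open>Here \<open>G\<close> transports skew symmetry from one variable into another group,
  sending -\<partial> - \<lambda> to \<open>T\<close>. Below, \<open>G\<close> is either a renaming
  of the bracket variable or the extension of a conformal linear map.\<close>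

lemma skew_symmetry_image:
  assumes a: "a \<in> R d" and b: "b \<in> R e"
    and G: "additive G" and T: "additive T"
    and comm: "\<And>q. G (- map_poly (del act) q - pCons 0 q) = T (G q)"
  shows "G (br a b) = - koszul (d * e) (psubst T (\<lambda>c. G [:c:]) (br b a))"
proof -
  have S: "additive (\<lambda>q. - map_poly (del act) q - pCons 0 q)"
    by (intro additive_uminus_minus additive_map_poly additive_act additive_pCons_0)
  show ?thesis
    by (subst skew_symmetry[OF a b])
      (simp add: additive.minus[OF G] koszul_commute[OF G]
        additive_comp_psubst[OF G S T, of "\<lambda>c. [:c:]", simplified, OF comm])
qed

text \<open>Take \<open>G\<close> to be \<open>psubst T const2\<close> in the preceding lemma: it
  commutes with \<partial> and sends the bracket variable to \<open>T\<close>.\<close>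

lemma psubst_const2_br_swap:
  assumes a: "a \<in> R d" and b: "b \<in> R e" and T: "T \<in> {mu2, lammu2}"
  shows "psubst T const2 (br a b)
    = - koszul (d * e) (psubst (\<lambda>q. - map_poly2 (del act) q - T q) const2 (br b a))"
proof -
  have addT: "additive T"
    using T by (auto intro: additive_mu2 additive_lammu2)
  note T0 = additive.zero[OF addT] and c0 = additive.zero[OF additive_const2]
  have G: "additive (psubst T const2)"
    by (intro additive_psubst addT additive_const2)
  have "additive (\<lambda>q. - map_poly2 (del act) q - T q)"
    by (intro additive_uminus_minus additive_map_poly additive_act addT)
  from skew_symmetry_image[OF a b G this] T show ?thesis
    by (simp add: additive.diff[OF G] additive.minus[OF G] psubst_pCons[where h = const2, OF addT c0]
        psubst_0 T0 c0
        map_poly2_psubst_const2[OF additive_act])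
qed

text \<open>For each coefficient \<open>c\<close> of \<open>f a\<close>, the bracket of
  \<open>b\<close> and \<open>c\<close> at \<mu> becomes one at -\<partial> - \<lambda> - \<mu>,
  hence up to sign the bracket of \<open>c\<close> and \<open>b\<close> at \<lambda> + \<mu>. The
  sign involves \<open>d + \<theta>\<close>, the degree of \<open>c\<close>.\<close>

lemma br_right_swap:
  assumes f: "f \<in> Cend_deg act R \<theta>" and a: "a \<in> R d" and b: "b \<in> R e"
  shows "refl_mu (del act) (br_right br f b a) = - koszul ((d + \<theta>) * e) (br_left br f a b)"
proof -
  let ?T = "\<lambda>q. - map_poly2 (del act) q - lammu2 q"
  have "refl_mu (del act) (br_right br f b a) = psubst lam2 (\<lambda>c. psubst ?T const2 (br b c)) (f a)"
    unfolding br_right_def apply_ext_def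
    by (subst refl_mu_psubst[OF additive_act additive_lam2 additive_lam2])
      (simp_all add: refl_mu_lam2 refl_mu_psubst_mu2 additive_act
        additive.zero[OF additive_psubst_br_right[OF additive_mu2]])
  \<comment> \<open>Skew symmetry is applied to the right-hand side, where its sign cancels the one
    already present.\<close>
  also have "\<dots> = psubst lam2 (\<lambda>c. - koszul ((d + \<theta>) * e) (psubst lammu2 const2 (br c b))) (f a)"
    by (rule psubst_cong)
      (subst psubst_const2_br_swap[OF Cend_coeff[OF f a] b], simp, simp only: minus_koszul_minus_koszul)
  also have "\<dots> = - koszul ((d + \<theta>) * e) (br_left br f a b)"
    unfolding br_left_def apply_ext_def
    by (rule koszul_psubst[OF additive_lam2])
      (rule additive.zero[OF additive_psubst_br_left[OF additive_lammu2]])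
  finally show ?thesis .
qed

text \<open>The mirror image of \<open>br_right_swap\<close>: \<lambda> + \<mu> becomes -\<partial>
  - \<mu>, and the coefficients of \<open>f b\<close> have degree
  \<open>e + \<theta>\<close>.\<close>

lemma br_left_swap:
  assumes f: "f \<in> Cend_deg act R \<theta>" and a: "a \<in> R d" and b: "b \<in> R e"
  shows "refl_mu (del act) (br_left br f b a) = - koszul (d * (e + \<theta>)) (br_right br f a b)"
proof -
  let ?T = "\<lambda>q. - map_poly2 (del act) q - mu2 q"
  have "refl_mu (del act) (br_left br f b a) = psubst lam2 (\<lambda>c. psubst ?T const2 (br c a)) (f b)"
    unfolding br_left_def apply_ext_def
    by (subst refl_mu_psubst[OF additive_act additive_lam2 additive_lam2])
      (simp_all add: refl_mu_lam2 refl_mu_psubst_lammu2 additive_act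
        additive.zero[OF additive_psubst_br_left[OF additive_lammu2]])
  also have "\<dots> = psubst lam2 (\<lambda>c. - koszul (d * (e + \<theta>)) (psubst mu2 const2 (br a c))) (f b)"
    by (rule psubst_cong)
      (subst psubst_const2_br_swap[OF a Cend_coeff[OF f b]], simp, simp only: minus_koszul_minus_koszul)
  also have "\<dots> = - koszul (d * (e + \<theta>)) (br_right br f a b)"
    unfolding br_right_def apply_ext_def
    by (rule koszul_psubst[OF additive_lam2])
      (rule additive.zero[OF additive_psubst_br_right[OF additive_mu2]])
  finally show ?thesis .
qed

text \<open>Skew symmetry inside \<open>f\<close> replaces \<mu> by -\<partial> - \<mu>. Moving
  \<partial> out through the conformal map turns it into \<partial> + \<lambda>, so the result is
  exactly the substitution of -\<partial> - \<lambda> - \<mu>.\<close>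

lemma map_br_swap:
  assumes f: "f \<in> Cend_deg act R \<theta>" and a: "a \<in> R d" and b: "b \<in> R e"
  shows "refl_mu (del act) (map_br br f b a) = - koszul (d * e) (map_br br f a b)"
proof -
  let ?T = "\<lambda>q. - map_poly2 (del act) q - lammu2 q"
  let ?h = "\<lambda>c. psubst lam2 const2 (f c)"
  note h = additive_psubst_Cend[OF Cend_additive[OF f]]
  note h0 = additive.zero[OF h] and c0 = additive.zero[OF additive_const2]
  note D = additive_map_poly[OF additive_map_poly[OF additive_act[of "[:0, 1:]"]]]
  \<comment> \<open>This \<open>G\<close> is the linear extension of \<open>f\<close> to polynomials
    in \<mu>.\<close>
  have G: "additive (psubst mu2 ?h)"
    by (intro additive_psubst additive_mu2 h)
  have h_del: "?h (del act c) = map_poly2 (del act) (?h c) + lam2 (?h c)" for c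
    by (simp add: Cend_del[OF f] additive.add[OF additive_psubst[OF additive_lam2 additive_const2]]
        map_poly2_psubst_const2 additive_act psubst_pCons[where h = const2, OF additive_lam2 c0] c0)
  have G_del: "psubst mu2 ?h (map_poly (del act) q)
      = map_poly2 (del act) (psubst mu2 ?h q) + lam2 (psubst mu2 ?h q)" for q
  proof -
    have "psubst mu2 ?h (map_poly (del act) q) = psubst mu2 (\<lambda>c. ?h (del act c)) q"
      by (simp add: psubst_map_poly[OF additive_mu2] h0)
    also have "\<dots> = psubst mu2 (\<lambda>c. map_poly2 (del act) (?h c) + lam2 (?h c)) q"
      by (simp only: h_del)
    also have "\<dots> = psubst mu2 (\<lambda>c. map_poly2 (del act) (?h c)) q + psubst mu2 (\<lambda>c. lam2 (?h c)) q"
      by (rule psubst_add_fun[OF additive_mu2])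
        (simp_all add: h0 additive.zero[OF additive_lam2])
    also have "psubst mu2 (\<lambda>c. map_poly2 (del act) (?h c)) q = map_poly2 (del act) (psubst mu2 ?h q)"
      by (rule additive_comp_psubst[OF D additive_mu2 additive_mu2, symmetric])
        (simp_all add: h0 map_poly2_mu2)
    also have "psubst mu2 (\<lambda>c. lam2 (?h c)) q = lam2 (psubst mu2 ?h q)"
      by (rule additive_comp_psubst[OF additive_lam2 additive_mu2 additive_mu2, symmetric])
        (simp_all add: h0 lam2_mu2)
    finally show ?thesis .
  qed
  \<comment> \<open>The values of \<open>f\<close> involve \<lambda> only and are fixed, so only the
    powers of \<mu> coming from the bracket change.\<close>
  have "refl_mu (del act) (map_br br f b a) = psubst ?T ?h (br b a)"
    unfolding map_br_def apply_ext_def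
    by (subst refl_mu_psubst[OF additive_act additive_mu2 additive_refl_lammu[OF additive_act]])
      (simp_all add: refl_mu_mu2 refl_mu_psubst_lam2 additive_act h0)
  moreover have "map_br br f a b = - koszul (d * e) (psubst ?T (\<lambda>c. psubst mu2 ?h [:c:]) (br b a))"
    unfolding map_br_def apply_ext_def
    by (rule skew_symmetry_image[OF a b G additive_refl_lammu[OF additive_act]])
      (simp add: additive.diff[OF G] additive.minus[OF G] G_del
        psubst_pCons[OF additive_mu2] h0 lammu2_def)
  moreover have "psubst mu2 ?h [:c:] = ?h c" for c
    by (simp add: psubst_pCons[OF additive_mu2] h0 psubst_0 additive.zero[OF additive_mu2])
  ultimately show ?thesis
    by (simp add: koszul_def)
qed

text \<open>The companion \<open>f'\<close> is thereby itself a generalized derivation, with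
  companions \<open>f\<close> and \<open>f''\<close>. The three swap lemmas are applied to the
  identity for \<open>b\<close> and \<open>a\<close>.\<close>

lemma GDer_identity_swap:
  assumes f: "f \<in> Cend_deg act R \<theta>" and f': "f' \<in> Cend_deg act R \<theta>"
    and f'': "f'' \<in> Cend_deg act R \<theta>"
    and eq: "\<And>d a b. a \<in> R d \<Longrightarrow>
      br_left br f a b + koszul (\<theta> * d) (br_right br f' a b) = map_br br f'' a b"
    and a: "a \<in> R d"
  shows "br_left br f' a b + koszul (\<theta> * d) (br_right br f a b) = map_br br f'' a b"
proof -
  have hom: "br_left br f' a b + koszul (\<theta> * d) (br_right br f a b) = map_br br f'' a b"
    if b: "b \<in> R e" for b e
  proof -
    note refl = additive_refl_mu[OF additive_act[of "[:0, 1:]"]]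
    have "refl_mu (del act) (br_left br f b a + koszul (\<theta> * e) (br_right br f' b a))
        = refl_mu (del act) (map_br br f'' b a)"
      by (simp only: eq[OF b])
    then have "- koszul (d * (e + \<theta>)) (br_right br f a b)
        + koszul (\<theta> * e) (- koszul ((d + \<theta>) * e) (br_left br f' a b))
        = - koszul (d * e) (map_br br f'' a b)"
      by (simp only: additive.add[OF refl] koszul_commute[OF refl]
          br_left_swap[OF f a b] br_right_swap[OF f' a b] map_br_swap[OF f'' a b])
    \<comment> \<open>Multiplying by \<open>- koszul (d * e)\<close> leaves the sign of
      \<open>\<theta> * d\<close> on the term in \<open>f\<close>; on the term in \<open>f'\<close>
      the contribution \<open>\<theta> * e\<close> occurs twice and cancels.\<close>
    then show ?thesis
      by (cases d rule: bit_cases; cases e rule: bit_cases; cases \<theta> rule: bit_cases)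
        (simp_all add: koszul_def algebra_simps)
  qed
  \<comment> \<open>Both sides are additive in \<open>b\<close>, so the homogeneous components
    suffice.\<close>
  obtain b0 b1 where b: "b0 \<in> R 0" "b1 \<in> R 1" "b = b0 + b1"
    using components_sum[of b] by blast
  show ?thesis
    unfolding b(3) additive.add[OF additive_map_br_snd[OF Cend_additive[OF f'']]]
    by (simp add: additive.add[OF additive_br_left_snd] additive.add[OF additive_koszul]
        additive.add[OF additive_br_right_snd[OF Cend_additive[OF f]]] algebra_simps
        flip: hom[OF b(1)] hom[OF b(2)])
qed

section \<open>The decomposition in a fixed degree\<close>

lemma GDer_deg_eq: "GDer_deg act R br \<theta> = QDer_deg act R br \<theta> + QC_deg act R br \<theta>"
proof (intro equalityI subsetI)
  have neg: "act [:-1:] x = - x" for x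
  proof -
    have "[:-1:] = - (1 :: complex poly)"
      by (simp add: one_pCons)
    then show ?thesis
      by (simp only: scale_minus_left scale_one)
  qed
  have half: "act [:1 / 2:] x + act [:1 / 2:] x = x" for x
    using scale_left_distrib[of "[:1 / 2:]" "[:1 / 2:]" x] by (simp flip: one_pCons)
  let ?H = "map_poly2 (act [:1 / 2:])"
  have H: "additive ?H"
    by (intro additive_map_poly additive_act)
  have halfH: "?H q + ?H q = q" for q
    by (simp add: poly_eq_iff coeff_map_poly half)
  have neg2: "map_poly2 (act [:-1:]) q = - q" for q
    by (simp add: poly_eq_iff coeff_map_poly neg)
  note bilin = br_left_add br_right_add br_left_cscale br_right_cscale neg2
    additive.add[OF additive_koszul] additive.minus[OF additive_koszul]
  {
    fix f assume "f \<in> GDer_deg act R br \<theta>"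
    then obtain f' f'' where f: "f \<in> Cend_deg act R \<theta>" and f': "f' \<in> Cend_deg act R \<theta>"
      and f'': "f'' \<in> Cend_deg act R \<theta>"
      and eq: "\<And>d a b. a \<in> R d \<Longrightarrow>
        br_left br f a b + koszul (\<theta> * d) (br_right br f' a b) = map_br br f'' a b"
      by (auto simp: GDer_deg_def)
    note eq' = GDer_identity_swap[OF f f' f'' eq]
    \<comment> \<open>These are the half sum and half difference of \<open>f\<close> and
      \<open>f'\<close>; the difference is written with a multiple by -1 so that closure under sums
      and scalars covers both.\<close>
    let ?g = "cscale (1 / 2) (\<lambda>x. f x + f' x)" and ?h = "cscale (1 / 2) (\<lambda>x. f x + cscale (-1) f' x)"
    have "br_left br ?g a b + koszul (\<theta> * d) (br_right br ?g a b) = map_br br f'' a b"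
      if "a \<in> R d" for d a b
    proof -
      \<comment> \<open>Both identities have the same right-hand side, so half their sum has
        companion \<open>f''\<close> itself.\<close>
      have "br_left br ?g a b + koszul (\<theta> * d) (br_right br ?g a b)
          = ?H ((br_left br f a b + koszul (\<theta> * d) (br_right br f' a b))
            + (br_left br f' a b + koszul (\<theta> * d) (br_right br f a b)))"
        by (simp add: bilin additive.add[OF H] koszul_commute[OF H] algebra_simps)
      also have "\<dots> = map_br br f'' a b"
        by (simp only: eq[OF that] eq'[OF _ that] additive.add[OF H] halfH)
      finally show ?thesis .
    qed
    then have g: "?g \<in> QDer_deg act R br \<theta>"
      unfolding QDer_deg_def using f'' Cend_deg_cscale[OF Cend_deg_add[OF f f']] by blast
    have "br_left br ?h a b = koszul (\<theta> * d) (br_right br ?h a b)" if "a \<in> R d" for d a b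
    proof -
      have "br_left br f a b + koszul (\<theta> * d) (br_right br f' a b)
          = br_left br f' a b + koszul (\<theta> * d) (br_right br f a b)"
        by (simp only: eq[OF that] eq'[OF _ that])
      then have "br_left br f a b - br_left br f' a b
          = koszul (\<theta> * d) (br_right br f a b - br_right br f' a b)"
        by (simp add: additive.diff[OF additive_koszul] algebra_simps)
      then show ?thesis
        by (simp add: bilin flip: koszul_commute[OF H])
    qed
    then have h: "?h \<in> QC_deg act R br \<theta>"
      unfolding QC_deg_def using Cend_deg_cscale[OF Cend_deg_add[OF f Cend_deg_cscale[OF f']]] by blast
    have "?g + ?h = f"
      by (simp add: fun_eq_iff poly_eq_iff coeff_map_poly scale_right_distrib neg half
          scale_right_diff_distrib)
    then show "f \<in> QDer_deg act R br \<theta> + QC_deg act R br \<theta>"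
      using set_plus_intro[OF g h] by (simp only:)
  next
    fix f assume "f \<in> QDer_deg act R br \<theta> + QC_deg act R br \<theta>"
    then obtain g h where "f = g + h" and g: "g \<in> QDer_deg act R br \<theta>"
      and h: "h \<in> QC_deg act R br \<theta>"
      by (rule set_plus_elim)
    then have f: "f = (\<lambda>x. g x + h x)"
      by (simp add: plus_fun_def)
    from g obtain g' where g': "g' \<in> Cend_deg act R \<theta>" and eq_g: "\<And>d a b. a \<in> R d \<Longrightarrow>
        br_left br g a b + koszul (\<theta> * d) (br_right br g a b) = map_br br g' a b"
      by (auto simp: QDer_deg_def)
    from h have eq_h: "br_left br h a b = koszul (\<theta> * d) (br_right br h a b)" if "a \<in> R d" for d a b
      using that by (auto simp: QC_deg_def)
    have gC: "g \<in> Cend_deg act R \<theta>" and hC: "h \<in> Cend_deg act R \<theta>"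
      using g h by (simp_all add: QDer_deg_def QC_deg_def)
    \<comment> \<open>For the converse the companion is \<open>g - h\<close>: the quasicentroid
      identity makes the two terms in \<open>h\<close> cancel, leaving the quasiderivation identity
      of \<open>g\<close>.\<close>
    let ?k = "\<lambda>x. g x + cscale (-1) h x"
    have "br_left br f a b + koszul (\<theta> * d) (br_right br ?k a b) = map_br br g' a b"
      if "a \<in> R d" for d a b
      unfolding f by (simp add: bilin eq_h[OF that] additive.diff[OF additive_koszul] algebra_simps
          flip: eq_g[OF that])
    moreover have "f \<in> Cend_deg act R \<theta>" and "?k \<in> Cend_deg act R \<theta>"
      unfolding f by (rule Cend_deg_add[OF gC hC], rule Cend_deg_add[OF gC Cend_deg_cscale[OF hC]])
    ultimately show "f \<in> GDer_deg act R br \<theta>"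
      unfolding GDer_deg_def using g' by blast
  }
qed

end

theorem theorem4p4:
  fixes act :: "complex poly \<Rightarrow> 'a::ab_group_add \<Rightarrow> 'a"
    and R :: "bit \<Rightarrow> 'a set"
    and br :: "'a \<Rightarrow> 'a \<Rightarrow> 'a poly"
  assumes "lie_conformal_superalgebra act R br"
  shows "GDer act R br = QDer act R br + QC act R br"
proof -
  interpret lie_conformal_superalgebra act R br by fact
  show ?thesis
    \<comment> \<open>The decompositions in degrees 0 and 1 are added and the four summands
      regrouped.\<close>
    unfolding GDer_def QDer_def QC_def GDer_deg_eq
    by (simp only: ac_simps)
qed

end
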